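(* Let $k\ge 1$. Consider the Mealy automaton with state set $Q=\{q_0,\dots,q_k\}$, alphabet $S=\{0,1\}$, transition function $\varphi:Q\times S\to Q$ and output function $\psi:Q\times S\to S$ given by $$\varphi(q_i,1)=q_{i+1},\ \psi(q_i,1)=0\quad (0\le i<k),\qquad \varphi(q_k,1)=q_k,\ \psi(q_k,1)=1,$$ $$\varphi(q_i,0)=q_{i-1},\ \psi(q_i,0)=1\quad (0<i\le k),\qquad \varphi(q_0,0)=q_0,\ \psi(q_0,0)=0.$$ Then this automaton started at $q_0$ describes the box-ball system with carrier capacity $k$: for every ball configuration $\bar s\in S^{\mathbb N}$ with finitely many $1$'s, the configuration obtained from $\bar s$ after one time step of the box-ball system with carrier capacity $k$ is $\mathbf A_{q_0}(\bar s)$. Moreover, the (simple) box-ball system is described in the same way by the limiting automaton as $k\to\infty$, i.e. the one with states $q_i$, $i\in\{0,1,2,\dots\}$, and $\varphi(q_i,1)=q_{i+1}$, $\psi(q_i,1)=0$ for all $i\ge 0$; $\varphi(q_i,0)=q_{i-1}$, $\psi(q_i,0)=1$ for all $i>0$; $\varphi(q_0,0)=q_0$, $\psi(q_0,0)=0$.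
   Context: Mealy automaton: given a state set $Q$, an alphabet $S$ and functions $\varphi:Q\times S\to Q$, $\psi:Q\times S\to S$, each $q\in Q$ defines a map $\mathbf A_q:S^{\mathbb N}\to S^{\mathbb N}$, $\mathbf A_q(s_0,s_1,\dots)=(s_0',s_1',\dots)$, by $s_i'=\psi(r_i,s_i)$, $r_{i+1}=\varphi(r_i,s_i)$, $r_0=q$. Box-ball system (BBS): there is an array of infinitely many boxes, each containing at most one ball, with finitely many balls in total; a configuration is encoded by a $0/1$ sequence ($1$ = box contains a ball, $0$ = box is empty). In one time step an initially empty carrier moves from left to right, passing each box once. In the simple BBS the carrier can hold arbitrarily many balls: when it passes a box containing a ball, it takes the ball; when it passes an empty box and it holds at least one ball, it puts one ball into the box (if it holds none, nothing happens). In the BBS with carrier capacity $k$ the carrier can hold at most $k$ balls, and the only difference is that when the carrier holds $k$ balls and passes a box containing a ball, it does nothing. *)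

theory Defs
  imports Main "HOL-Library.FuncSet" "HOL-Library.Extended_Nat"
begin

definition mealy_automaton ::
  "'q set \<Rightarrow> 's set \<Rightarrow> ('q \<times> 's \<Rightarrow> 'q) \<Rightarrow> ('q \<times> 's \<Rightarrow> 's) \<Rightarrow> bool" where
  "mealy_automaton Q S \<phi> \<psi> \<longleftrightarrow> \<phi> \<in> Q \<times> S \<rightarrow> Q \<and> \<psi> \<in> Q \<times> S \<rightarrow> S"

primrec mealy_state :: "('q \<times> 's \<Rightarrow> 'q) \<Rightarrow> 'q \<Rightarrow> (nat \<Rightarrow> 's) \<Rightarrow> nat \<Rightarrow> 'q" where
  "mealy_state \<phi> q s 0 = q"
| "mealy_state \<phi> q s (Suc i) = \<phi> (mealy_state \<phi> q s i, s i)"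

definition mealy_map ::
  "('q \<times> 's \<Rightarrow> 'q) \<Rightarrow> ('q \<times> 's \<Rightarrow> 's) \<Rightarrow> 'q \<Rightarrow> (nat \<Rightarrow> 's) \<Rightarrow> (nat \<Rightarrow> 's)" where
  "mealy_map \<phi> \<psi> q s = (\<lambda>i. \<psi> (mealy_state \<phi> q s i, s i))"

text \<open>The state \<open>q\<^sub>i\<close> is represented by its index \<open>i\<close>. The tables constrain
  \<open>\<phi>\<close> and \<open>\<psi>\<close> only on states times \<open>{0, 1}\<close>; elsewhere they are arbitrary.\<close>

definition capacity_table ::
  "nat \<Rightarrow> (nat \<times> nat \<Rightarrow> nat) \<Rightarrow> (nat \<times> nat \<Rightarrow> nat) \<Rightarrow> bool" where
  "capacity_table k \<phi> \<psi> \<longleftrightarrow>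
     (\<forall>i. 0 \<le> i \<and> i < k \<longrightarrow> \<phi> (i, 1) = i + 1 \<and> \<psi> (i, 1) = 0) \<and>
     \<phi> (k, 1) = k \<and> \<psi> (k, 1) = 1 \<and>
     (\<forall>i. 0 < i \<and> i \<le> k \<longrightarrow> \<phi> (i, 0) = i - 1 \<and> \<psi> (i, 0) = 1) \<and>
     \<phi> (0, 0) = 0 \<and> \<psi> (0, 0) = 0"

definition limit_table ::
  "(nat \<times> nat \<Rightarrow> nat) \<Rightarrow> (nat \<times> nat \<Rightarrow> nat) \<Rightarrow> bool" where
  "limit_table \<phi> \<psi> \<longleftrightarrow>
     (\<forall>i. \<phi> (i, 1) = i + 1 \<and> \<psi> (i, 1) = 0) \<and>
     (\<forall>i. 0 < i \<longrightarrow> \<phi> (i, 0) = i - 1 \<and> \<psi> (i, 0) = 1) \<and>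
     \<phi> (0, 0) = 0 \<and> \<psi> (0, 0) = 0"

definition ball_configuration :: "(nat \<Rightarrow> nat) \<Rightarrow> bool" where
  "ball_configuration s \<longleftrightarrow> (\<forall>i. s i \<in> {0, 1}) \<and> finite {i. s i = 1}"

text \<open>The pair \<open>(s, c)\<close> is the current content of the boxes together with the number \<open>c\<close>
  of balls in the carrier. Capacity \<open>\<infinity>\<close> gives the simple box-ball system.\<close>

fun carrier_pass :: "enat \<Rightarrow> nat \<Rightarrow> (nat \<Rightarrow> nat) \<times> nat \<Rightarrow> (nat \<Rightarrow> nat) \<times> nat" where
  "carrier_pass K i (s, c) =
     (if s i = 1 then (if enat c < K then (s(i := 0), c + 1) else (s, c))
      else (if c \<ge> 1 then (s(i := 1), c - 1) else (s, c)))"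

text \<open>Boxes and carrier after an initially empty carrier has passed the boxes \<open>0, \<dots>, n - 1\<close>.\<close>

primrec carrier_run :: "enat \<Rightarrow> (nat \<Rightarrow> nat) \<Rightarrow> nat \<Rightarrow> (nat \<Rightarrow> nat) \<times> nat" where
  "carrier_run K s 0 = (s, 0)"
| "carrier_run K s (Suc n) = carrier_pass K n (carrier_run K s n)"

text \<open>The carrier passes every box exactly once, so the content of box \<open>i\<close> at the end of the
  time step is its content right after the carrier has passed it; see \<open>carrier_run_final\<close>.\<close>

definition bbs_step :: "enat \<Rightarrow> (nat \<Rightarrow> nat) \<Rightarrow> (nat \<Rightarrow> nat)" where
  "bbs_step K s = (\<lambda>i. fst (carrier_run K s (Suc i)) i)"

lemma carrier_pass_other: "j \<noteq> i \<Longrightarrow> fst (carrier_pass K i x) j = fst x j"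
  by (cases x) auto

lemma carrier_run_final:
  assumes "i < n"
  shows "fst (carrier_run K s n) i = bbs_step K s i"
proof -
  from assms have "Suc i \<le> n" by simp
  then show ?thesis
  proof (induction n rule: dec_induct)
    case base
    show ?case by (simp add: bbs_step_def)
  next
    case (step n)
    then show ?case by (simp add: carrier_pass_other)
  qed
qed

end

theory Submission
  imports Defs
begin

text \<open>
  The state \<open>q\<^sub>i\<close> means that the carrier holds \<open>i\<close> balls. With this reading each line of either
  table is one rule for the carrier at a single box: the output letter is the new content of the
  box and the next state is the new load. The word-level claim follows from this local agreement
  because the carrier meets every box before it has touched it, so that it reads the original
  letter \<open>s n\<close> at box \<open>n\<close> just as the automaton does (\<open>carrier_run_ahead\<close>), and because the load
  never exceeds the capacity, so that the tables always apply (\<open>carrier_run_load_le\<close>). An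
  induction along the array then identifies load and state (\<open>carrier_load_eq_mealy_state\<close>).

  The local agreement is stated for a capacity in \<^typ>\<open>enat\<close>, so that the finite automata and
  their limit are two instances of one theorem. No passage to the limit in \<open>k\<close> is
  involved: infinite capacity just removes the case of a full carrier.
\<close>

lemma carrier_pass_load_le:
  assumes "enat (snd x) \<le> K"
  shows "enat (snd (carrier_pass K i x)) \<le> K"
proof (cases x)
  case (Pair s c)
  have "enat (c + 1) \<le> K" if "enat c < K"
    using that by (cases K) auto
  moreover have "enat (c - 1) \<le> K"
    using assms Pair by (cases K) auto
  ultimately show ?thesis
    using assms Pair by auto
qed

lemma carrier_run_load_le: "enat (snd (carrier_run K s n)) \<le> K"
  by (induction n) (simp_all add: carrier_pass_load_le flip: zero_enat_def)

lemma carrier_run_ahead: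
  assumes "n \<le> j"
  shows "fst (carrier_run K s n) j = s j"
  using assms by (induction n) (simp_all add: carrier_pass_other)

text \<open>
  Loads above \<open>K\<close> and letters other than \<open>0\<close> and \<open>1\<close> are left open, since the tables fix the
  automaton only where these do not occur.
\<close>

definition simulates_carrier ::
  "enat \<Rightarrow> (nat \<times> nat \<Rightarrow> nat) \<Rightarrow> (nat \<times> nat \<Rightarrow> nat) \<Rightarrow> bool" where
  "simulates_carrier K \<phi> \<psi> \<longleftrightarrow>
     (\<forall>s c i. enat c \<le> K \<and> s i \<in> {0, 1} \<longrightarrow>
        carrier_pass K i (s, c) = (s(i := \<psi> (c, s i)), \<phi> (c, s i)))"

lemma carrier_run_Suc_simulated:
  assumes "simulates_carrier K \<phi> \<psi>" and "s n \<in> {0, 1}"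
  shows "carrier_run K s (Suc n) =
    ((fst (carrier_run K s n))(n := \<psi> (snd (carrier_run K s n), s n)),
     \<phi> (snd (carrier_run K s n), s n))"
proof -
  obtain t c where run: "carrier_run K s n = (t, c)"
    by (cases "carrier_run K s n")
  have "t n = s n"
    using carrier_run_ahead[of n n K s] run by simp
  moreover have "enat c \<le> K"
    using carrier_run_load_le[of K s n] run by simp
  moreover have "carrier_pass K n (t, c) = (t(n := \<psi> (c, t n)), \<phi> (c, t n))"
    if "enat c \<le> K" "t n \<in> {0, 1}"
    using assms(1) that unfolding simulates_carrier_def by blast
  ultimately have "carrier_pass K n (t, c) = (t(n := \<psi> (c, s n)), \<phi> (c, s n))"
    using assms(2) by simp
  then show ?thesis
    using run by simp
qed

lemma carrier_load_eq_mealy_state: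
  assumes "simulates_carrier K \<phi> \<psi>" and "\<And>i. s i \<in> {0, 1}"
  shows "snd (carrier_run K s n) = mealy_state \<phi> 0 s n"
proof (induction n)
  case 0
  show ?case by simp
next
  case (Suc n)
  then show ?case
    by (simp add: carrier_run_Suc_simulated[OF assms(1), of s, OF assms(2)] del: carrier_run.simps)
qed

theorem bbs_step_eq_mealy_map:
  assumes "simulates_carrier K \<phi> \<psi>" and "\<And>i. s i \<in> {0, 1}"
  shows "bbs_step K s = mealy_map \<phi> \<psi> 0 s"
  unfolding bbs_step_def mealy_map_def
  by (simp add: carrier_run_Suc_simulated[OF assms(1), of s, OF assms(2)] carrier_load_eq_mealy_state[OF assms]
      del: carrier_run.simps)

text \<open>
  Where the carrier leaves a box alone, the table writes the letter already there: \<open>1\<close> at a ball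
  when the carrier is full, \<open>0\<close> at an empty box when it is empty. Both cases are therefore trivial updates of \<open>s\<close>.
\<close>

lemma simulates_carrier_capacity_table:
  assumes "capacity_table k \<phi> \<psi>"
  shows "simulates_carrier (enat k) \<phi> \<psi>"
  unfolding simulates_carrier_def
proof (intro allI impI, elim conjE)
  fix s :: "nat \<Rightarrow> nat" and c i :: nat
  assume "enat c \<le> enat k" and "s i \<in> {0, 1}"
  then consider "s i = 1" "c < k" | "s i = 1" "c = k" | "s i = 0" "0 < c" "c \<le> k"
    | "s i = 0" "c = 0"
    by fastforce
  then show "carrier_pass (enat k) i (s, c) = (s(i := \<psi> (c, s i)), \<phi> (c, s i))"
    using assms by cases (auto simp: capacity_table_def fun_upd_idem)
qed

lemma simulates_carrier_limit_table:
  assumes "limit_table \<phi> \<psi>"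
  shows "simulates_carrier \<infinity> \<phi> \<psi>"
  unfolding simulates_carrier_def
proof (intro allI impI, elim conjE)
  fix s :: "nat \<Rightarrow> nat" and c i :: nat
  assume "s i \<in> {0, 1}"
  then consider "s i = 1" | "s i = 0" "0 < c" | "s i = 0" "c = 0"
    by fastforce
  then show "carrier_pass \<infinity> i (s, c) = (s(i := \<psi> (c, s i)), \<phi> (c, s i))"
    using assms by cases (auto simp: limit_table_def fun_upd_idem)
qed

lemma mealy_automaton_capacity_table:
  assumes "capacity_table k \<phi> \<psi>"
  shows "mealy_automaton {0..k} {0, 1} \<phi> \<psi>"
proof -
  have "\<phi> (c, a) \<in> {0..k} \<and> \<psi> (c, a) \<in> {0, 1}" if "c \<le> k" "a \<in> {0, 1}" for c a
  proof -
    from that consider "a = 1" "c < k" | "a = 1" "c = k" | "a = 0" "0 < c" | "a = 0" "c = 0"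
      by fastforce
    then show ?thesis
      using assms that(1) by cases (auto simp: capacity_table_def)
  qed
  then show ?thesis
    unfolding mealy_automaton_def
    by (intro conjI funcsetI)
      (auto simp only: mem_Times_iff atLeastAtMost_iff split_paired_all fst_conv snd_conv
        UNIV_I)
qed

lemma mealy_automaton_limit_table:
  assumes "limit_table \<phi> \<psi>"
  shows "mealy_automaton UNIV {0, 1} \<phi> \<psi>"
proof -
  have "\<psi> (c, a) \<in> {0, 1}" if "a \<in> {0, 1}" for c a
    using assms that by (cases "c = 0") (auto simp: limit_table_def)
  then show ?thesis
    unfolding mealy_automaton_def
    by (intro conjI funcsetI)
      (auto simp only: mem_Times_iff atLeastAtMost_iff split_paired_all fst_conv snd_conv
        UNIV_I)
qed

theorem lemma3p1:
  "(\<forall>k \<ge> 1. \<forall>\<phi> \<psi>. capacity_table k \<phi> \<psi> \<longrightarrow>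
      mealy_automaton {0..k} {0, 1} \<phi> \<psi> \<and>
      (\<forall>s. ball_configuration s \<longrightarrow> bbs_step (enat k) s = mealy_map \<phi> \<psi> 0 s)) \<and>
   (\<forall>\<phi> \<psi>. limit_table \<phi> \<psi> \<longrightarrow>
      mealy_automaton UNIV {0, 1} \<phi> \<psi> \<and>
      (\<forall>s. ball_configuration s \<longrightarrow> bbs_step \<infinity> s = mealy_map \<phi> \<psi> 0 s))"
proof -
  have step: "bbs_step K s = mealy_map \<phi> \<psi> 0 s"
    if "simulates_carrier K \<phi> \<psi>" "ball_configuration s" for K \<phi> \<psi> s
    using that bbs_step_eq_mealy_map unfolding ball_configuration_def by blast
  show ?thesis
    by (intro conjI allI impI step simulates_carrier_capacity_table simulates_carrier_limit_table
        mealy_automaton_capacity_table mealy_automaton_limit_table)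
qed

end
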